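(* Let $T\in(\mathbb{C}^n)^{\otimes3}$ be an $r$-diagonalisable symmetric tensor with $\kappa(T)\le B$, and let $T_1,\dots,T_n$ be its slices. Let $\eta\in(0,1)$ with $1/\eta$ an integer, pick $a\in G_\eta^n$ uniformly at random, and set $T^{(a)}=\sum_{i=1}^na_iT_i$. Then for every $k_F>nB^3$, $$\Pr_{a\in G_\eta^n}\big[\mathrm{rank}(T^{(a)})=r\ \text{and}\ \kappa_F(T^{(a)})\le k_F\big]\ \ge\ 1-\Big(2rC_{CW}\alpha_F+\frac{r\eta}{2}\Big),$$ where $\alpha_F=\sqrt{3B}\Big(\sqrt{\frac{rB^2}{k_F-nB^3}}+\eta\sqrt{nB}\Big)$.
   Context: $T$ is $r$-diagonalisable if $T=\sum_{i=1}^ru_i^{\otimes3}$ with $u_1,\dots,u_r\in\mathbb{C}^n$ linearly independent; $\kappa(T)=\|U\|_F^2+\|U^\dagger\|_F^2$ where $U\in\mathbb{C}^{r\times n}$ has rows $u_i$ and $\dagger$ is the Moore–Penrose pseudoinverse (independent of the decomposition). The $k$-th slice of $T$ is $T_k=(T_{ijk})_{i,j}$. For a matrix $M$, $\kappa_F(M)=\|M\|_F^2+\|M^\dagger\|_F^2$. The grid is $G_\eta=\{-1,-1+\eta,-1+2\eta,\dots,1-2\eta,1-\eta\}$. $C_{CW}>0$ is the universal constant from the Carbery–Wright anti-concentration inequality. *)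

theory Defs
  imports "HOL-Probability.Probability" "Jordan_Normal_Form.Schur_Decomposition" "Jordan_Normal_Form.DL_Rank"
begin

(* Tensors in (C^n)^{\<otimes>3} are represented as T :: nat => nat => nat => complex,
   only entries with indices < n being relevant. Matrices are JNF matrices. *)

definition fro_sq :: "complex mat \<Rightarrow> real" where
  "fro_sq M = (\<Sum>i<dim_row M. \<Sum>j<dim_col M. (cmod (M $$ (i,j)))^2)"

definition pinv :: "complex mat \<Rightarrow> complex mat" where
  "pinv M = (SOME X. X \<in> carrier_mat (dim_col M) (dim_row M) \<and>
      M * X * M = M \<and> X * M * X = X \<and>
      mat_adjoint (M * X) = M * X \<and> mat_adjoint (X * M) = X * M)"

definition kappaF :: "complex mat \<Rightarrow> real" where
  "kappaF M = fro_sq M + fro_sq (pinv M)"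

definition diag_decomp :: "nat \<Rightarrow> nat \<Rightarrow> (nat \<Rightarrow> nat \<Rightarrow> nat \<Rightarrow> complex) \<Rightarrow> complex mat \<Rightarrow> bool" where
  "diag_decomp n r T U \<longleftrightarrow> U \<in> carrier_mat r n \<and> distinct (rows U) \<and>
     \<not> LinearCombinations.module.lin_dep class_ring (module_vec TYPE(complex) n) (set (rows U)) \<and>
     (\<forall>i<n. \<forall>j<n. \<forall>k<n. T i j k = (\<Sum>l<r. U $$ (l,i) * U $$ (l,j) * U $$ (l,k)))"

definition r_diagonalisable :: "nat \<Rightarrow> nat \<Rightarrow> (nat \<Rightarrow> nat \<Rightarrow> nat \<Rightarrow> complex) \<Rightarrow> bool" where
  "r_diagonalisable n r T \<longleftrightarrow> (\<exists>U. diag_decomp n r T U)"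

definition kappa_tensor :: "nat \<Rightarrow> nat \<Rightarrow> (nat \<Rightarrow> nat \<Rightarrow> nat \<Rightarrow> complex) \<Rightarrow> real" where
  "kappa_tensor n r T = (let U = (SOME U. diag_decomp n r T U) in fro_sq U + fro_sq (pinv U))"

definition slice :: "nat \<Rightarrow> (nat \<Rightarrow> nat \<Rightarrow> nat \<Rightarrow> complex) \<Rightarrow> nat \<Rightarrow> complex mat" where
  "slice n T k = mat n n (\<lambda>(i,j). T i j k)"

definition slice_comb :: "nat \<Rightarrow> (nat \<Rightarrow> nat \<Rightarrow> nat \<Rightarrow> complex) \<Rightarrow> (nat \<Rightarrow> real) \<Rightarrow> complex mat" where
  "slice_comb n T a = mat n n (\<lambda>(i,j). \<Sum>k<n. complex_of_real (a k) * (slice n T k) $$ (i,j))"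

definition grid :: "real \<Rightarrow> real set" where
  "grid \<eta> = (\<lambda>k. -1 + real k * \<eta>) ` {0..<nat \<lfloor>2 / \<eta>\<rfloor>}"

definition is_poly :: "nat \<Rightarrow> nat \<Rightarrow> ((nat \<Rightarrow> real) \<Rightarrow> real) \<Rightarrow> bool" where
  "is_poly m d p \<longleftrightarrow> (\<exists>c. \<forall>x. p x =
     (\<Sum>e\<in>{e \<in> {..<m} \<rightarrow>\<^sub>E {..d}. sum e {..<m} \<le> d}. c e * (\<Prod>i<m. x i ^ e i)))"

(* C is a constant for which the Carbery-Wright anti-concentration inequality holds
   (for x uniform on the cube [-1,1]^m) *)
definition cw_constant :: "real \<Rightarrow> bool" where
  "cw_constant C \<longleftrightarrow> C > 0 \<and> (\<forall>m d p \<epsilon>. m \<ge> 1 \<longrightarrow> d \<ge> 1 \<longrightarrow> is_poly m d p \<longrightarrow> \<epsilon> > 0 \<longrightarrow>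
     (let M = PiM {..<m} (\<lambda>_. uniform_measure lborel {-1..1::real});
          E = integral\<^sup>L M (\<lambda>x. (p x)^2)
      in E > 0 \<longrightarrow>
         measure M {x \<in> space M. \<bar>p x\<bar> \<le> \<epsilon>} \<le> C * real d * (\<epsilon> / sqrt E) powr (1 / real d)))"

end

theory Submission
  imports Defs
begin

text \<open>
  Let the rows of U be the components of the decomposition and V its pseudoinverse. Then
  \<open>T\<^sup>(\<^sup>a\<^sup>) = U\<^sup>T D U\<close> with \<open>D = diag \<langle>a, u\<^sub>l\<rangle>\<close>, and the four Penrose equations show that
  \<open>V D\<^sup>-\<^sup>1 V\<^sup>T\<close> is its pseudoinverse. So if all \<open>\<bar>\<langle>a, u\<^sub>l\<rangle>\<bar> \<ge> \<delta>\<close>, then the rank is r and the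
  condition number is at most \<open>n B\<^sup>3 + B\<^sup>2 / \<delta>\<^sup>2\<close>. It remains to bound the probability that a single
  \<open>\<bar>\<langle>a, u\<^sub>l\<rangle>\<bar>\<close> is below \<open>\<delta>\<close>. The cells \<open>a + [0,\<eta>)\<^sup>n\<close> over the grid points tile the cube, and moving
  inside a cell changes the linear form by at most \<open>\<eta> \<surd>(n B)\<close>; hence the probability over the grid is
  at most the one over the cube with \<open>\<delta>\<close> enlarged by this amount. There the Carbery-Wright inequality
  applies to the quadratic polynomial \<open>p(x) = \<bar>\<langle>x, u\<^sub>l\<rangle>\<bar>\<^sup>2\<close>, because
  \<open>E p\<^sup>2 \<ge> (E p)\<^sup>2 = (\<parallel>u\<^sub>l\<parallel>\<^sup>2 / 3)\<^sup>2\<close> and \<open>\<parallel>u\<^sub>l\<parallel>\<^sup>2 \<ge> 1 / B\<close>.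
\<close>

section \<open>Moore-Penrose inverses\<close>

lemma mat_adjoint_dim [simp]:
  "dim_row (mat_adjoint A) = dim_col A" "dim_col (mat_adjoint A) = dim_row A"
  by (simp_all add: mat_adjoint_def)

lemma mat_adjoint_index [simp]:
  fixes A :: "complex mat"
  assumes "i < dim_col A" "j < dim_row A"
  shows "mat_adjoint A $$ (i,j) = cnj (A $$ (j,i))"
  using assms by (simp add: mat_adjoint_def mat_of_rows_index)

lemma mat_adjoint_carrier [simp, intro]:
  "A \<in> carrier_mat m n \<Longrightarrow> mat_adjoint A \<in> carrier_mat n m"
  by (intro carrier_matI) auto

lemma mat_adjoint_mult:
  fixes A :: "complex mat"
  assumes "A \<in> carrier_mat m k" "B \<in> carrier_mat k n"
  shows "mat_adjoint (A * B) = mat_adjoint B * mat_adjoint A"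
  using assms by (intro eq_matI) (auto simp: scalar_prod_def mult.commute)

lemma mat_adjoint_adjoint [simp]:
  fixes A :: "complex mat"
  shows "mat_adjoint (mat_adjoint A) = A"
  by (intro eq_matI) auto

lemma mat_adjoint_one [simp]: "mat_adjoint (1\<^sub>m n) = (1\<^sub>m n :: complex mat)"
  by (intro eq_matI) auto

text \<open>This is the predicate under the \<open>SOME\<close> in \<open>pinv\<close>; once it is
  known to have at most one solution, \<open>pinv\<close> is computed by exhibiting a
  candidate.\<close>

definition penrose_inverse :: "complex mat \<Rightarrow> complex mat \<Rightarrow> bool" where
  "penrose_inverse M X \<longleftrightarrow> X \<in> carrier_mat (dim_col M) (dim_row M) \<and>
      M * X * M = M \<and> X * M * X = X \<and>
      mat_adjoint (M * X) = M * X \<and> mat_adjoint (X * M) = X * M"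

text \<open>From \<open>M = M * Y * M\<close> one gets \<open>M * X = (M * Y) * (M * X)\<close>.
  Taking adjoints swaps the two Hermitian factors, so
  \<open>M * X = (M * X) * (M * Y) = M * Y\<close>. Symmetrically \<open>X * M = Y * M\<close>, and
  then X = XMX = XMY = YMY = Y.\<close>

lemma penrose_inverse_unique:
  assumes "penrose_inverse M X" "penrose_inverse M Y"
  shows "X = Y"
proof -
  define m n where "m = dim_row M" and "n = dim_col M"
  have M: "M \<in> carrier_mat m n" by (simp add: m_def n_def)
  have X: "X \<in> carrier_mat n m" and Y: "Y \<in> carrier_mat n m"
    using assms by (auto simp: penrose_inverse_def m_def n_def)
  note x = assms(1)[unfolded penrose_inverse_def] and y = assms(2)[unfolded penrose_inverse_def]
  have MX: "M * X \<in> carrier_mat m m" and MY: "M * Y \<in> carrier_mat m m"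
    and XM: "X * M \<in> carrier_mat n n" and YM: "Y * M \<in> carrier_mat n n"
    using M X Y by auto
  have "M * X = (M * Y * M) * X" using y by simp
  also have "\<dots> = (M * Y) * (M * X)" using M X Y MY by (metis assoc_mult_mat)
  finally have "mat_adjoint (M * X) = mat_adjoint (M * X) * mat_adjoint (M * Y)"
    using mat_adjoint_mult[OF MY MX] by simp
  then have "M * X = (M * X) * (M * Y)" using x y by simp
  also have "\<dots> = (M * X * M) * Y" using M X Y MX by (metis assoc_mult_mat)
  finally have 1: "M * X = M * Y" using x by simp
  have "X * M = X * (M * Y * M)" using y by simp
  also have "\<dots> = (X * M) * (Y * M)" using M X Y by (metis assoc_mult_mat mult_carrier_mat)
  finally have "mat_adjoint (X * M) = mat_adjoint (Y * M) * mat_adjoint (X * M)"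
    using mat_adjoint_mult[OF XM YM] by simp
  then have "X * M = (Y * M) * (X * M)" using x y by simp
  also have "\<dots> = Y * (M * X * M)" using M X Y by (metis assoc_mult_mat mult_carrier_mat)
  finally have 2: "X * M = Y * M" using x by simp
  have "X = X * (M * X)" using x assoc_mult_mat[OF X M X] by simp
  also have "\<dots> = (X * M) * Y" using 1 assoc_mult_mat[OF X M Y] by simp
  also have "\<dots> = Y" using 2 y by simp
  finally show ?thesis .
qed

lemma pinv_eqI: "penrose_inverse M X \<Longrightarrow> pinv M = X"
  unfolding pinv_def penrose_inverse_def[symmetric]
  by (rule some_equality) (auto intro: penrose_inverse_unique)

lemma penrose_inverse_of_right_inverse:
  assumes "U \<in> carrier_mat r n" "V \<in> carrier_mat n r"
    and "U * V = 1\<^sub>m r" "mat_adjoint (V * U) = V * U"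
  shows "penrose_inverse U V"
  using assms by (auto simp: penrose_inverse_def)

text \<open>The squared norm of y = U* v equals the Hermitian product of v with U y = U U* v, which
  is zero.\<close>

lemma kernel_mult_mat_adjoint:
  fixes U :: "complex mat"
  assumes U: "U \<in> carrier_mat r n" and v: "v \<in> carrier_vec r"
    and ker: "U * mat_adjoint U *\<^sub>v v = 0\<^sub>v r"
  shows "mat_adjoint U *\<^sub>v v = 0\<^sub>v n"
proof -
  define y where "y = mat_adjoint U *\<^sub>v v"
  have y: "y \<in> carrier_vec n"
    unfolding y_def by (rule mult_mat_vec_carrier[OF mat_adjoint_carrier[OF U] v])
  have yi: "y $ i = (\<Sum>l<r. cnj (U $$ (l,i)) * v $ l)" if "i < n" for i
    using that U v by (auto simp: y_def scalar_prod_def atLeast0LessThan intro!: sum.cong)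
  have "U *\<^sub>v y = 0\<^sub>v r"
    using ker assoc_mult_mat_vec[OF U mat_adjoint_carrier[OF U] v] by (simp add: y_def)
  then have Uy: "(\<Sum>i<n. U $$ (l,i) * y $ i) = 0" if "l < r" for l
  proof -
    have "(U *\<^sub>v y) $ l = (\<Sum>i<n. U $$ (l,i) * y $ i)"
      using that U y by (auto simp: scalar_prod_def atLeast0LessThan)
    with \<open>U *\<^sub>v y = 0\<^sub>v r\<close> that show ?thesis by simp
  qed
  have "complex_of_real (\<Sum>i<n. (cmod (y $ i))\<^sup>2) = (\<Sum>i<n. cnj (y $ i) * y $ i)"
    by (simp add: complex_norm_square mult.commute del: of_real_power)
  also have "\<dots> = (\<Sum>i<n. \<Sum>l<r. U $$ (l,i) * cnj (v $ l) * y $ i)"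
    by (intro sum.cong refl) (simp add: yi sum_distrib_right)
  also have "\<dots> = (\<Sum>l<r. cnj (v $ l) * (\<Sum>i<n. U $$ (l,i) * y $ i))"
    by (subst sum.swap) (simp add: sum_distrib_left mult_ac)
  also have "\<dots> = 0" by (simp add: Uy)
  finally have "(\<Sum>i<n. (cmod (y $ i))\<^sup>2) = 0" by (simp only: of_real_eq_0_iff)
  then have "\<forall>i<n. y $ i = 0" by (simp add: sum_nonneg_eq_0_iff)
  then show ?thesis using y unfolding y_def[symmetric] by (intro eq_vecI) auto
qed

text \<open>The product is the combination of the rows of \<open>U\<close> with coefficients
  \<open>w\<close>. Independence speaks of the set of rows, and distinctness excludes the relations
  between equal rows that a set cannot see.\<close>

lemma lin_indpt_rows_mult_vec_eq_0:
  fixes U :: "complex mat"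
  assumes U: "U \<in> carrier_mat r n" and "distinct (rows U)"
    and "\<not> LinearCombinations.module.lin_dep class_ring (module_vec TYPE(complex) n) (set (rows U))"
    and "w \<in> carrier_vec r" and "transpose_mat U *\<^sub>v w = 0\<^sub>v n"
  shows "w = 0\<^sub>v r"
  using vec_space.lin_depI[of "transpose_mat U" n r w] assms by auto

text \<open>The witness is V = U* H, where H is the inverse of the Gram matrix G = U U*. A kernel
  vector of G would give a linear relation between the rows. As G is Hermitian, so is H, and hence
  so is V U = U* H U.\<close>

lemma lin_indpt_rows_penrose_inverse:
  fixes U :: "complex mat"
  assumes U: "U \<in> carrier_mat r n" and dist: "distinct (rows U)"
    and indep: "\<not> LinearCombinations.module.lin_dep class_ring (module_vec TYPE(complex) n) (set (rows U))"
  obtains V where "V \<in> carrier_mat n r" "U * V = 1\<^sub>m r" "mat_adjoint (V * U) = V * U"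
proof -
  define G where "G = U * mat_adjoint U"
  have A: "mat_adjoint U \<in> carrier_mat n r" and G: "G \<in> carrier_mat r r"
    using U by (auto simp: G_def)
  have "det G \<noteq> 0"
  proof
    assume "det G = 0"
    then obtain v where v: "v \<in> carrier_vec r" "v \<noteq> 0\<^sub>v r" "G *\<^sub>v v = 0\<^sub>v r"
      using det_0_iff_vec_prod_zero[OF G] by blast
    have *: "mat_adjoint U *\<^sub>v v = 0\<^sub>v n"
      using kernel_mult_mat_adjoint[OF U v(1)] v(3) by (simp add: G_def)
    \<comment> \<open>The rows are combined by the plain transpose, not the adjoint, so the kernel
      vector has to be conjugated.\<close>
    have "transpose_mat U *\<^sub>v conjugate v = 0\<^sub>v n"
    proof (rule eq_vecI)
      fix i assume i: "i < dim_vec (0\<^sub>v n :: complex vec)"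
      have "cnj ((mat_adjoint U *\<^sub>v v) $ i) = (transpose_mat U *\<^sub>v conjugate v) $ i"
        using i U v(1) by (auto simp: scalar_prod_def intro!: sum.cong)
      then show "(transpose_mat U *\<^sub>v conjugate v) $ i = 0\<^sub>v n $ i"
        using * i by simp
    qed (use U in auto)
    then have "conjugate v = 0\<^sub>v r"
      by (intro lin_indpt_rows_mult_vec_eq_0[OF U dist indep] carrier_vec_conjugate v(1))
    then have "conjugate (conjugate v) = 0\<^sub>v r" by simp
    with v show False by simp
  qed
  then obtain H where H: "H \<in> carrier_mat r r" "H * G = 1\<^sub>m r" "G * H = 1\<^sub>m r"
    using det_non_zero_imp_unit[OF G, of "()"] G by (auto simp: Units_def ring_mat_simps)
  have adjG: "mat_adjoint G = G" unfolding G_def using mat_adjoint_mult[OF U A] by simp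
  have "mat_adjoint H * G = 1\<^sub>m r"
    using mat_adjoint_mult[OF G H(1)] H(3) adjG by simp
  \<comment> \<open>\<open>mat_adjoint H\<close> is a left inverse of \<open>G\<close> and
    \<open>H\<close> is a right inverse, so they coincide.\<close>
  then have adjH: "mat_adjoint H = H"
    using H(1,3) G assoc_mult_mat[OF mat_adjoint_carrier[OF H(1)] G H(1)]
    by (metis left_mult_one_mat mat_adjoint_carrier right_mult_one_mat)
  show ?thesis
  proof
    show V: "mat_adjoint U * H \<in> carrier_mat n r" using A H(1) by auto
    show "U * (mat_adjoint U * H) = 1\<^sub>m r"
      using assoc_mult_mat[OF U A H(1)] H(3) by (simp add: G_def)
    show "mat_adjoint (mat_adjoint U * H * U) = mat_adjoint U * H * U"
      using mat_adjoint_mult[OF V U] mat_adjoint_mult[OF A H(1)] adjH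
        assoc_mult_mat[OF A H(1) U] by simp
  qed
qed

section \<open>Slice combinations of a diagonalisable tensor\<close>

text \<open>Every column of \<open>A * B\<close> is a combination of columns of \<open>A\<close>, so
  one column space lies in the other and the dimensions compare.\<close>

lemma rank_mult_le:
  fixes A :: "complex mat"
  assumes A: "A \<in> carrier_mat n m" and B: "B \<in> carrier_mat m k"
  shows "vec_space.rank n (A * B) \<le> vec_space.rank n A"
proof -
  interpret vec_space "TYPE(complex)" n .
  have AB: "A * B \<in> carrier_mat n k" using A B by auto
  have cA: "set (cols A) \<subseteq> carrier_vec n" and cAB: "set (cols (A * B)) \<subseteq> carrier_vec n"
    using A AB cols_dim by (metis carrier_matD(1))+
  have "col_space (A * B) \<subseteq> col_space A"
    unfolding col_space_eq[OF A] col_space_eq[OF AB] using A B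
    by (auto intro!: bexI[where x = "B *\<^sub>v _"])
  then have sub: "span (set (cols (A * B))) \<subseteq> span (set (cols A))"
    by (simp add: col_space_def)
  have sA: "subspace class_ring (span (set (cols A))) V"
    and sAB: "subspace class_ring (span (set (cols (A * B)))) V"
    using cA cAB by (auto intro: span_is_subspace)
  have "subspace class_ring (span (set (cols (A * B)))) (vs (span (set (cols A))))"
    using nested_subspaces[OF sA sAB sub] .
  from vectorspace.subspace_dim[OF subspace_is_vs[OF sA] this] show ?thesis
    unfolding rank_def using fin_dim_span_cols[OF A] fin_dim_span_cols[OF AB] by simp
qed

text \<open>The left side is the squared Frobenius norm of W diag(c) W^T, written in entries.
  Cauchy-Schwarz bounds the squared (i,j) entry by K^2 \<open>w i * w j\<close>, and the double sum
  of these products factors as a square.\<close>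

lemma sum_norm_sq_congruence_le:
  fixes W :: "nat \<Rightarrow> nat \<Rightarrow> complex"
  assumes "\<And>l. l < r \<Longrightarrow> cmod (c l) \<le> K"
  shows "(\<Sum>i<n. \<Sum>j<n. (cmod (\<Sum>l<r. c l * W i l * W j l))\<^sup>2)
    \<le> K\<^sup>2 * (\<Sum>i<n. \<Sum>l<r. (cmod (W i l))\<^sup>2)\<^sup>2"
proof -
  define w where "w i = (\<Sum>l<r. (cmod (W i l))\<^sup>2)" for i
  have "(cmod (\<Sum>l<r. c l * W i l * W j l))\<^sup>2 \<le> K\<^sup>2 * (w i * w j)" for i j
  proof -
    have "cmod (\<Sum>l<r. c l * W i l * W j l) \<le> (\<Sum>l<r. K * (cmod (W i l) * cmod (W j l)))"
      using assms by (intro sum_norm_le) (auto simp: norm_mult mult.assoc intro!: mult_right_mono)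
    then have "(cmod (\<Sum>l<r. c l * W i l * W j l))\<^sup>2
        \<le> (K * (\<Sum>l<r. cmod (W i l) * cmod (W j l)))\<^sup>2"
      by (intro power_mono) (auto simp: sum_distrib_left)
    also have "\<dots> \<le> K\<^sup>2 * (w i * w j)"
      unfolding power_mult_distrib w_def
      by (intro mult_left_mono Cauchy_Schwarz_ineq_sum) auto
    finally show ?thesis .
  qed
  then have "(\<Sum>i<n. \<Sum>j<n. (cmod (\<Sum>l<r. c l * W i l * W j l))\<^sup>2)
      \<le> (\<Sum>i<n. \<Sum>j<n. K\<^sup>2 * (w i * w j))"
    by (intro sum_mono)
  also have "\<dots> = K\<^sup>2 * (\<Sum>i<n. w i)\<^sup>2"
    unfolding power2_eq_square[of "sum w {..<n}"] by (simp only: sum_product, simp only: sum_distrib_left)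
  finally show ?thesis by (simp add: w_def)
qed

lemma fro_sq_congruence_le:
  assumes W: "W \<in> carrier_mat n r" and c: "\<And>l. l < r \<Longrightarrow> cmod (c l) \<le> K"
  shows "fro_sq (W * mat_diag r c * transpose_mat W) \<le> K\<^sup>2 * (fro_sq W)\<^sup>2"
proof -
  have "(W * mat_diag r c * transpose_mat W) $$ (i,j)
      = (\<Sum>l<r. c l * W $$ (i,l) * W $$ (j,l))" if "i < n" "j < n" for i j
    using that W by (auto simp: mat_diag_mult_right[OF W] scalar_prod_def atLeast0LessThan
        mult_ac intro!: sum.cong)
  then have "fro_sq (W * mat_diag r c * transpose_mat W)
      = (\<Sum>i<n. \<Sum>j<n. (cmod (\<Sum>l<r. c l * W $$ (i,l) * W $$ (j,l)))\<^sup>2)"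
    using W by (simp add: fro_sq_def)
  also have "\<dots> \<le> K\<^sup>2 * (fro_sq W)\<^sup>2"
    using sum_norm_sq_congruence_le[where r = r and c = c and K = K and n = n and W = "\<lambda>i l. W $$ (i,l)"] c W by (simp add: fro_sq_def)
  finally show ?thesis .
qed

lemma fro_sq_transpose: "fro_sq (transpose_mat M) = fro_sq M"
  unfolding fro_sq_def by (subst sum.swap) simp

lemma fro_sq_nonneg: "0 \<le> fro_sq M"
  by (simp add: fro_sq_def sum_nonneg)

text \<open>These are the diagonal entries of D. The pairing is bilinear: the entries of
  \<open>U\<close> are not conjugated.\<close>

definition row_pairing :: "nat \<Rightarrow> complex mat \<Rightarrow> (nat \<Rightarrow> real) \<Rightarrow> nat \<Rightarrow> complex" where
  "row_pairing n U a l = (\<Sum>k<n. complex_of_real (a k) * U $$ (l,k))"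

text \<open>The k-th slice is U^T diag(\<open>U $$ (l,k)\<close>) U, and the combination with
  weights \<open>a k\<close> adds up the middle factors.\<close>

lemma slice_comb_diag_decomp:
  assumes "diag_decomp n r T U"
  shows "slice_comb n T a = transpose_mat U * mat_diag r (row_pairing n U a) * U"
proof (rule eq_matI)
  have U: "U \<in> carrier_mat r n" using assms by (simp add: diag_decomp_def)
  have Ut: "transpose_mat U \<in> carrier_mat n r" using U by simp
  show "dim_row (slice_comb n T a) = dim_row (transpose_mat U * mat_diag r (row_pairing n U a) * U)"
    "dim_col (slice_comb n T a) = dim_col (transpose_mat U * mat_diag r (row_pairing n U a) * U)"
    using U by (auto simp: slice_comb_def)
  fix i j assume "i < dim_row (transpose_mat U * mat_diag r (row_pairing n U a) * U)"
    "j < dim_col (transpose_mat U * mat_diag r (row_pairing n U a) * U)"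
  then have ij: "i < n" "j < n" using U by auto
  have "slice_comb n T a $$ (i,j)
      = (\<Sum>k<n. \<Sum>l<r. of_real (a k) * (U $$ (l,i) * U $$ (l,j) * U $$ (l,k)))"
    using ij assms by (auto simp: slice_comb_def slice_def diag_decomp_def sum_distrib_left
        intro!: sum.cong)
  also have "\<dots> = (\<Sum>l<r. U $$ (l,i) * row_pairing n U a l * U $$ (l,j))"
    by (subst sum.swap) (simp add: row_pairing_def sum_distrib_left sum_distrib_right mult_ac)
  also have "\<dots> = (transpose_mat U * mat_diag r (row_pairing n U a) * U) $$ (i,j)"
    using ij U by (auto simp: mat_diag_mult_right[OF Ut] scalar_prod_def atLeast0LessThan
        intro!: sum.cong)
  finally show "slice_comb n T a $$ (i,j)
    = (transpose_mat U * mat_diag r (row_pairing n U a) * U) $$ (i,j)" .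
qed

section \<open>Congruences U^T D U by a matrix with independent rows\<close>

locale full_row_rank =
  fixes r n :: nat and U V :: "complex mat"
  assumes U [simp]: "U \<in> carrier_mat r n" and V [simp]: "V \<in> carrier_mat n r"
    and UV: "U * V = 1\<^sub>m r" and VU: "mat_adjoint (V * U) = V * U"
    and dist: "distinct (rows U)"
    and indep: "\<not> LinearCombinations.module.lin_dep class_ring (module_vec TYPE(complex) n) (set (rows U))"
begin

lemma VtUt: "transpose_mat V * transpose_mat U = 1\<^sub>m r"
  using transpose_mult[OF U V] UV by (metis transpose_one)

text \<open>All three products collapse in the middle: U V = 1, V^T U^T = 1, and D cancels against
  its inverse.\<close>

lemma congruence_mult_pinv:
  assumes d: "\<And>l. l < r \<Longrightarrow> d l \<noteq> 0"
  defines "M \<equiv> transpose_mat U * mat_diag r d * U"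
    and "X \<equiv> V * mat_diag r (\<lambda>l. inverse (d l)) * transpose_mat V"
  shows "M * X = transpose_mat (V * U)" and "X * M = V * U"
    and "M * V = transpose_mat U * mat_diag r d"
proof -
  let ?D = "mat_diag r d" and ?E = "mat_diag r (\<lambda>l. inverse (d l))"
  let ?Ut = "transpose_mat U" and ?Vt = "transpose_mat V"
  have c: "?D \<in> carrier_mat r r" "?E \<in> carrier_mat r r" "?Ut \<in> carrier_mat n r"
    "?Vt \<in> carrier_mat r n" by auto
  have DE: "?D * ?E = 1\<^sub>m r" "?E * ?D = 1\<^sub>m r"
    unfolding mat_diag_diag using d by (auto simp: mat_diag_def intro!: eq_matI)
  have UtD: "?Ut * ?D \<in> carrier_mat n r" and VE: "V * ?E \<in> carrier_mat n r"
    using c by (auto intro: mult_carrier_mat[of _ n r])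
  show MV: "M * V = ?Ut * ?D"
    unfolding M_def using assoc_mult_mat[OF UtD U V] UV right_mult_one_mat[OF UtD] by simp
  have M: "M \<in> carrier_mat n n" unfolding M_def using UtD by auto
  have "M * X = M * V * ?E * ?Vt"
    unfolding X_def using assoc_mult_mat[OF M VE c(4)] assoc_mult_mat[OF M V c(2)] by simp
  also have "\<dots> = ?Ut * ?Vt"
    unfolding MV using assoc_mult_mat[OF c(3) c(1) c(2)] DE right_mult_one_mat[OF c(3)] by simp
  finally show "M * X = transpose_mat (V * U)" using transpose_mult[OF V U] by simp
  have "X * M = V * ?E * (?Vt * (?Ut * ?D * U))"
    unfolding X_def M_def using assoc_mult_mat[OF VE c(4), of "?Ut * ?D * U" n] UtD by auto
  also have "?Vt * (?Ut * ?D * U) = ?D * U"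
    using assoc_mult_mat[OF c(4) UtD U] assoc_mult_mat[OF c(4,3,1)] VtUt c by simp
  also have "V * ?E * (?D * U) = V * (?E * ?D) * U"
    using assoc_mult_mat[OF VE c(1) U] assoc_mult_mat[OF V c(2) c(1)] by simp
  finally show "X * M = V * U" using DE right_mult_one_mat[OF V] by simp
qed

text \<open>Both products of \<open>?M\<close> and \<open>?X\<close> are Hermitian, being V U and
  its transpose. The other two Penrose equations follow by absorbing V U, since U V = 1 gives
  \<open>?M * (V * U) = ?M\<close> and \<open>V * U * ?X = ?X\<close>.\<close>

lemma pinv_congruence:
  assumes d: "\<And>l. l < r \<Longrightarrow> d l \<noteq> 0"
  shows "pinv (transpose_mat U * mat_diag r d * U)
    = V * mat_diag r (\<lambda>l. inverse (d l)) * transpose_mat V"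
proof (rule pinv_eqI)
  let ?D = "mat_diag r d" and ?E = "mat_diag r (\<lambda>l. inverse (d l))"
  let ?Ut = "transpose_mat U" and ?Vt = "transpose_mat V"
  let ?M = "?Ut * ?D * U" and ?X = "V * ?E * ?Vt"
  have c: "?D \<in> carrier_mat r r" "?E \<in> carrier_mat r r" "?Ut \<in> carrier_mat n r"
    "?Vt \<in> carrier_mat r n" by auto
  have UtD: "?Ut * ?D \<in> carrier_mat n r" and VE: "V * ?E \<in> carrier_mat n r"
    using c by (auto intro: mult_carrier_mat[of _ n r])
  have M: "?M \<in> carrier_mat n n" and X: "?X \<in> carrier_mat n n"
    using UtD VE by auto
  have P: "V * U \<in> carrier_mat n n" by (rule mult_carrier_mat[OF V U])
  note e = congruence_mult_pinv[of d, OF d]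
  have "?M * ?X * ?M = ?M * (V * U)"
    using assoc_mult_mat[OF M X M] e(2) by simp
  also have "\<dots> = ?M"
    using assoc_mult_mat[OF M V U] e(3) by simp
  finally have 1: "?M * ?X * ?M = ?M" .
  have "V * U * V = V" using assoc_mult_mat[OF V U V] UV V by simp
  then have "V * U * ?X = ?X"
    using assoc_mult_mat[OF P VE c(4)] assoc_mult_mat[OF P V c(2)] by simp
  then have 2: "?X * ?M * ?X = ?X" using e(2) by simp
  \<comment> \<open>Adjoint and transpose commute, so the transpose of the Hermitian matrix V U is
    again Hermitian.\<close>
  have "mat_adjoint (transpose_mat (V * U)) = transpose_mat (mat_adjoint (V * U))"
    by (intro eq_matI) auto
  then have 3: "mat_adjoint (transpose_mat (V * U)) = transpose_mat (V * U)"
    using VU by simp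
  show "penrose_inverse ?M ?X"
    unfolding penrose_inverse_def using 1 2 3 e VU M X by auto
qed

text \<open>The product and U^T factor through each other: multiplying U^T on the right by D U gives
  the product, and multiplying the product by V D^-1 gives U^T back. The columns of U^T are
  independent, so its rank is r.\<close>

lemma rank_congruence:
  assumes d: "\<And>l. l < r \<Longrightarrow> d l \<noteq> 0"
  shows "vec_space.rank n (transpose_mat U * mat_diag r d * U) = r"
proof -
  let ?D = "mat_diag r d" and ?E = "mat_diag r (\<lambda>l. inverse (d l))"
  let ?Ut = "transpose_mat U"
  let ?M = "?Ut * ?D * U"
  have c: "?D \<in> carrier_mat r r" "?E \<in> carrier_mat r r" "?Ut \<in> carrier_mat n r" by auto
  have UtD: "?Ut * ?D \<in> carrier_mat n r" and VE: "V * ?E \<in> carrier_mat n r"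
    using c by (auto intro: mult_carrier_mat[of _ n r])
  have M: "?M \<in> carrier_mat n n" using UtD by auto
  have DE: "?D * ?E = 1\<^sub>m r"
    unfolding mat_diag_diag using d by (auto simp: mat_diag_def intro!: eq_matI)
  have full: "vec_space.rank n ?Ut = r"
    using vec_space.lin_indpt_full_rank[OF c(3)] dist indep by simp
  have "vec_space.rank n (?Ut * (?D * U)) \<le> vec_space.rank n ?Ut"
    by (rule rank_mult_le[OF c(3)]) (auto intro: mult_carrier_mat[OF c(1) U])
  then have le: "vec_space.rank n ?M \<le> r"
    using assoc_mult_mat[OF c(3) c(1) U] full by simp
  have "?M * (V * ?E) = ?Ut"
    using assoc_mult_mat[OF M V c(2)] congruence_mult_pinv(3)[of d, OF d]
      assoc_mult_mat[OF c(3) c(1) c(2)] DE right_mult_one_mat[OF c(3)] by simp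
  then have "r \<le> vec_space.rank n ?M"
    using rank_mult_le[OF M VE] full by simp
  with le show ?thesis by simp
qed

lemma pinv_U: "pinv U = V"
  by (intro pinv_eqI penrose_inverse_of_right_inverse[OF U V UV VU])

text \<open>The matrix and its pseudoinverse both have the form W diag(c) W^T, with W = U^T and
  entries at most \<open>K\<close>, respectively W = V and entries at most 1/\<delta>.\<close>

lemma kappaF_congruence_le:
  assumes "\<delta> > 0" and "\<And>l. l < r \<Longrightarrow> \<delta> \<le> cmod (d l)" and "\<And>l. l < r \<Longrightarrow> cmod (d l) \<le> K"
  shows "kappaF (transpose_mat U * mat_diag r d * U)
    \<le> K\<^sup>2 * (fro_sq U)\<^sup>2 + (fro_sq V)\<^sup>2 / \<delta>\<^sup>2"
proof -
  have nz: "d l \<noteq> 0" if "l < r" for l using assms(1,2) that by force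
  have "fro_sq (transpose_mat U * mat_diag r d * U) \<le> K\<^sup>2 * (fro_sq U)\<^sup>2"
    using fro_sq_congruence_le[of "transpose_mat U" n r d K] assms(3) by (simp add: fro_sq_transpose)
  moreover have "fro_sq (V * mat_diag r (\<lambda>l. inverse (d l)) * transpose_mat V)
      \<le> (inverse \<delta>)\<^sup>2 * (fro_sq V)\<^sup>2"
    using assms(1,2) by (intro fro_sq_congruence_le[OF V]) (auto simp: norm_inverse le_imp_inverse_le)
  ultimately show ?thesis
    using pinv_congruence[of d] nz by (simp add: kappaF_def field_simps)
qed

text \<open>Cauchy-Schwarz applied to \<open>\<langle>u\<^sub>l, v\<^sub>l\<rangle> = 1\<close>, where \<open>v\<^sub>l\<close> is the l-th column of V.\<close>

lemma row_norm_sq_ge: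
  assumes "l < r"
  shows "1 \<le> (\<Sum>k<n. (cmod (U $$ (l,k)))\<^sup>2) * fro_sq V"
proof -
  have "(U * V) $$ (l,l) = (\<Sum>k<n. U $$ (l,k) * V $$ (k,l))"
    using assms U V by (simp add: scalar_prod_def atLeast0LessThan del: U V)
  then have "1 = cmod (\<Sum>k<n. U $$ (l,k) * V $$ (k,l))" using UV assms by simp
  also have "\<dots> \<le> (\<Sum>k<n. cmod (U $$ (l,k)) * cmod (V $$ (k,l)))"
    by (rule sum_norm_le) (simp add: norm_mult)
  finally have "1 \<le> (\<Sum>k<n. cmod (U $$ (l,k)) * cmod (V $$ (k,l)))\<^sup>2"
    by (simp add: one_le_power)
  also have "\<dots> \<le> (\<Sum>k<n. (cmod (U $$ (l,k)))\<^sup>2) * (\<Sum>k<n. (cmod (V $$ (k,l)))\<^sup>2)"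
    by (rule Cauchy_Schwarz_ineq_sum)
  also have "\<dots> \<le> (\<Sum>k<n. (cmod (U $$ (l,k)))\<^sup>2) * fro_sq V"
  proof (intro mult_left_mono)
    show "(\<Sum>k<n. (cmod (V $$ (k,l)))\<^sup>2) \<le> fro_sq V"
      unfolding fro_sq_def carrier_matD[OF V] using assms
      by (intro sum_mono member_le_sum) auto
  qed (simp add: sum_nonneg)
  finally show ?thesis .
qed

lemma row_norm_sq_le:
  assumes "l < r"
  shows "(\<Sum>k<n. (cmod (U $$ (l,k)))\<^sup>2) \<le> fro_sq U"
  unfolding fro_sq_def carrier_matD[OF U] using assms
  by (intro member_le_sum) (auto intro: sum_nonneg)

end

section \<open>Anti-concentration of linear forms on the grid\<close>

lemma finite_exponents: "finite {e \<in> {..<m::nat} \<rightarrow>\<^sub>E {..d}. sum e {..<m} \<le> (d::nat)}"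
  by (rule finite_subset[of _ "{..<m} \<rightarrow>\<^sub>E {..d}"]) (auto intro!: finite_PiE)

lemma is_poly_monom:
  assumes e: "e \<in> {..<m} \<rightarrow>\<^sub>E {..d}" "sum e {..<m} \<le> d"
  shows "is_poly m d (\<lambda>x. c * (\<Prod>i<m. x i ^ e i))"
  unfolding is_poly_def
proof (intro exI allI)
  fix x :: "nat \<Rightarrow> real"
  show "c * (\<Prod>i<m. x i ^ e i)
      = (\<Sum>e'\<in>{e \<in> {..<m} \<rightarrow>\<^sub>E {..d}. sum e {..<m} \<le> d}.
          (if e' = e then c else 0) * (\<Prod>i<m. x i ^ e' i))"
    using e by (subst sum.remove[OF finite_exponents, of e]) (auto intro!: sum.neutral)
qed

lemma is_poly_add:
  assumes "is_poly m d p" "is_poly m d q"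
  shows "is_poly m d (\<lambda>x. p x + q x)"
proof -
  obtain c c' where "\<forall>x. p x = (\<Sum>e\<in>{e \<in> {..<m} \<rightarrow>\<^sub>E {..d}. sum e {..<m} \<le> d}. c e * (\<Prod>i<m. x i ^ e i))"
    "\<forall>x. q x = (\<Sum>e\<in>{e \<in> {..<m} \<rightarrow>\<^sub>E {..d}. sum e {..<m} \<le> d}. c' e * (\<Prod>i<m. x i ^ e i))"
    using assms unfolding is_poly_def by auto
  then show ?thesis
    unfolding is_poly_def by (intro exI[of _ "\<lambda>e. c e + c' e"]) (simp add: distrib_right sum.distrib)
qed

lemma is_poly_zero: "is_poly m d (\<lambda>x. 0)"
  unfolding is_poly_def by (intro exI[of _ "\<lambda>_. 0"]) simp

lemma is_poly_sum:
  "finite I \<Longrightarrow> (\<And>i. i \<in> I \<Longrightarrow> is_poly m d (p i)) \<Longrightarrow> is_poly m d (\<lambda>x. \<Sum>i\<in>I. p i x)"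
  by (induction I rule: finite_induct) (auto intro: is_poly_zero is_poly_add)

text \<open>Adding two indicators in the exponent treats squares and mixed products alike; both the
  polynomial form and the moments rely on it.\<close>

lemma prod_power_pair:
  fixes x :: "nat \<Rightarrow> real"
  assumes "i < m" "j < m"
  shows "(\<Prod>k<m. x k ^ (of_bool (k = i) + of_bool (k = j))) = x i * x j"
proof -
  have "(\<Prod>k<m. x k ^ of_bool (k = i)) = x i" if "i < m" for i
    using that by (subst prod.remove[of _ i]) (auto intro!: prod.neutral)
  then show ?thesis using assms by (simp add: power_add prod.distrib)
qed

lemma is_poly_mult_vars:
  assumes "i < m" "j < m"
  shows "is_poly m 2 (\<lambda>x. c * (x i * x j))"
proof -
  \<comment> \<open>The restriction makes the exponent extensional, as membership in the index set
    of \<open>is_poly\<close> demands.\<close>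
  define e :: "nat \<Rightarrow> nat" where "e = restrict (\<lambda>k. of_bool (k = i) + of_bool (k = j)) {..<m}"
  have "e \<in> {..<m} \<rightarrow>\<^sub>E {..2}" by (auto simp: e_def)
  moreover have "sum e {..<m} \<le> 2"
    using assms by (simp add: e_def sum.distrib)
  ultimately have "is_poly m 2 (\<lambda>x. c * (\<Prod>k<m. x k ^ e k))" by (rule is_poly_monom)
  moreover have "(\<Prod>k<m. x k ^ e k) = x i * x j" for x :: "nat \<Rightarrow> real"
    using prod_power_pair[OF assms, of x] by (simp add: e_def)
  ultimately show ?thesis by simp
qed

section \<open>Moments of the uniform distribution on the cube\<close>

abbreviation uniform_interval :: "real measure" where
  "uniform_interval \<equiv> uniform_measure lborel {-1..1}"

text \<open>This is literally the measure in \<open>cw_constant\<close>, so that inequality applies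
  without conversion.\<close>

abbreviation uniform_cube :: "nat \<Rightarrow> (nat \<Rightarrow> real) measure" where
  "uniform_cube m \<equiv> PiM {..<m} (\<lambda>_. uniform_interval)"

interpretation uniform_interval: prob_space uniform_interval
  by (rule prob_space_uniform_measure) auto

interpretation uniform_cube: product_prob_space "\<lambda>_. uniform_interval" "{..<m}" for m :: nat
  by unfold_locales

interpretation uniform_cube: finite_product_prob_space "\<lambda>_. uniform_interval" "{..<m}" for m :: nat
  by unfold_locales auto

lemma AE_uniform_interval: "AE x in uniform_interval. \<bar>x\<bar> \<le> 1"
  by (rule AE_uniform_measureI) auto

lemma AE_uniform_cube: "AE x in uniform_cube m. \<forall>i<m. \<bar>x i\<bar> \<le> 1"
proof -
  have "AE x in uniform_cube m. \<forall>i\<in>{..<m}. \<bar>x i\<bar> \<le> 1"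
    by (intro AE_finite_allI AE_PiM_component AE_uniform_interval
        uniform_interval.prob_space_axioms) auto
  then show ?thesis by (rule AE_mp) auto
qed

text \<open>The value is 1/(k+1) for even \<open>k\<close> and 0 for odd \<open>k\<close>; the
  orders 0, 1 and 2 are used, with values 1, 0 and 1/3.\<close>

lemma uniform_interval_moment:
  "integrable uniform_interval (\<lambda>x. x ^ k)"
  "(\<integral>x. x ^ k \<partial>uniform_interval) = (1 - (-1) ^ Suc k) / (2 * real (Suc k))"
proof -
  show "integrable uniform_interval (\<lambda>x. x ^ k)"
  proof (rule uniform_interval.integrable_const_bound)
    show "AE x in uniform_interval. norm (x ^ k) \<le> 1"
      using AE_uniform_interval by eventually_elim (simp add: power_abs power_le_one)
  qed auto
  have "uniform_interval = density lborel (\<lambda>x. ennreal (indicator {-1..1} x / 2))"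
    unfolding uniform_measure_def
    by (intro density_cong) (auto split: split_indicator simp: divide_ennreal[symmetric])
  then have "(\<integral>x. x ^ k \<partial>uniform_interval)
      = (\<integral>x. indicator {-1..1} x / 2 * x ^ k \<partial>lborel)"
    by (simp only:) (subst integral_density, auto)
  also have "\<dots> = (\<integral>x. indicator {-1..1} x * x ^ k \<partial>lborel) / 2"
    by simp
  also have "(\<integral>x. indicator {-1..1} x * x ^ k \<partial>lborel) = (1 - (-1) ^ Suc k) / real (Suc k)"
    using integral_power[of "-1" 1 k] by (simp add: mult.commute diff_divide_distrib)
  finally show "(\<integral>x. x ^ k \<partial>uniform_interval) = (1 - (-1) ^ Suc k) / (2 * real (Suc k))"
    by simp
qed

text \<open>Under the product measure the integral factors into one-dimensional moments. For
  distinct indices a first moment occurs and vanishes; for equal ones the second moment 1/3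
  remains.\<close>

lemma uniform_cube_integral_vars:
  assumes "i < m" "j < m"
  shows "integrable (uniform_cube m) (\<lambda>x. x i * x j)"
    and "(\<integral>x. x i * x j \<partial>uniform_cube m) = (if i = j then 1/3 else 0)"
proof -
  let ?e = "\<lambda>k. of_bool (k = i) + of_bool (k = j) :: nat"
  have eq: "(\<lambda>x. x i * x j) = (\<lambda>x :: nat \<Rightarrow> real. \<Prod>k<m. x k ^ ?e k)"
    using prod_power_pair[OF assms] by simp
  show "integrable (uniform_cube m) (\<lambda>x. x i * x j)"
    unfolding eq by (rule uniform_cube.product_integrable_prod, rule finite_lessThan, rule uniform_interval_moment)
  have "(\<integral>x. x i * x j \<partial>uniform_cube m) = (\<Prod>k<m. \<integral>x. x ^ ?e k \<partial>uniform_interval)"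
    unfolding eq by (rule uniform_cube.product_integral_prod, rule finite_lessThan, rule uniform_interval_moment)
  also have "\<dots> = (if i = j then 1/3 else 0)"
  proof (cases "i = j")
    case True
    have "(\<Prod>k<m. \<integral>x. x ^ ?e k \<partial>uniform_interval) = (\<Prod>k<m. if k = i then 1/3 else 1)"
      unfolding uniform_interval_moment True by (intro prod.cong) auto
    with True assms show ?thesis by simp
  next
    case False
    then have "(\<integral>x. x ^ ?e i \<partial>uniform_interval) = 0"
      unfolding uniform_interval_moment by simp
    with assms(1) have "(\<Prod>k<m. \<integral>x. x ^ ?e k \<partial>uniform_interval) = 0"
      by (intro prod_zero finite_lessThan bexI[of _ i]) (simp_all only: lessThan_iff)
    with False show ?thesis by simp
  qed
  finally show "(\<integral>x. x i * x j \<partial>uniform_cube m) = (if i = j then 1/3 else 0)" .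
qed

section \<open>The squared modulus of a random linear form\<close>

definition form_norm_sq :: "nat \<Rightarrow> (nat \<Rightarrow> complex) \<Rightarrow> (nat \<Rightarrow> real) \<Rightarrow> real" where
  "form_norm_sq m u x = (cmod (\<Sum>k<m. complex_of_real (x k) * u k))\<^sup>2"

text \<open>Expand z times its conjugate; taking real parts yields the real coefficients that
  \<open>is_poly\<close> requires.\<close>

lemma form_norm_sq_expand:
  "form_norm_sq m u x = (\<Sum>i<m. \<Sum>j<m. Re (u i * cnj (u j)) * (x i * x j))"
proof -
  have "complex_of_real (form_norm_sq m u x)
      = (\<Sum>i<m. \<Sum>j<m. of_real (x i) * u i * cnj (of_real (x j) * u j))"
    unfolding form_norm_sq_def complex_norm_square cnj_sum sum_product ..
  from arg_cong[OF this, of Re] show ?thesis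
    by (simp add: algebra_simps)
qed

lemma is_poly_form_norm_sq: "is_poly m 2 (form_norm_sq m u)"
  unfolding form_norm_sq_expand[abs_def]
  by (intro is_poly_sum is_poly_mult_vars) auto

lemma integral_form_norm_sq:
  "integrable (uniform_cube m) (form_norm_sq m u)"
  "(\<integral>x. form_norm_sq m u x \<partial>uniform_cube m) = (\<Sum>k<m. (cmod (u k))\<^sup>2) / 3"
proof -
  show "integrable (uniform_cube m) (form_norm_sq m u)"
    unfolding form_norm_sq_expand[abs_def]
    by (intro Bochner_Integration.integrable_sum integrable_mult_right uniform_cube_integral_vars) auto
  have "(\<integral>x. form_norm_sq m u x \<partial>uniform_cube m)
      = (\<Sum>i<m. \<Sum>j<m. Re (u i * cnj (u j)) * (if i = j then 1/3 else 0))"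
    unfolding form_norm_sq_expand
    by (subst Bochner_Integration.integral_sum Bochner_Integration.integral_sum;
        (intro Bochner_Integration.integrable_sum integrable_mult_right uniform_cube_integral_vars)?;
        auto simp: uniform_cube_integral_vars intro!: sum.cong)
  also have "\<dots> = (\<Sum>k<m. (cmod (u k))\<^sup>2) / 3"
    by (simp add: if_distrib[of "\<lambda>t. _ * t"] sum_divide_distrib cmod_power2
        add_divide_distrib sum.distrib flip: power2_eq_square cong: if_cong)
  finally show "(\<integral>x. form_norm_sq m u x \<partial>uniform_cube m) = (\<Sum>k<m. (cmod (u k))\<^sup>2) / 3" .
qed

text \<open>Almost everywhere on the cube the coordinates are at most 1 in modulus, so the form is
  bounded by the sum of the \<open>cmod (u k)\<close>.\<close>

lemma integrable_form_norm_sq_sq: "integrable (uniform_cube m) (\<lambda>x. (form_norm_sq m u x)\<^sup>2)"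
proof (rule uniform_cube.integrable_const_bound)
  show "AE x in uniform_cube m. norm ((form_norm_sq m u x)\<^sup>2) \<le> (\<Sum>k<m. cmod (u k)) ^ 4"
    using AE_uniform_cube[of m]
  proof eventually_elim
    fix x :: "nat \<Rightarrow> real" assume x: "\<forall>i<m. \<bar>x i\<bar> \<le> 1"
    have "cmod (\<Sum>k<m. of_real (x k) * u k) \<le> (\<Sum>k<m. cmod (u k))"
      by (rule sum_norm_le) (use x in \<open>auto simp: norm_mult intro!: mult_left_le_one_le\<close>)
    then have "cmod (\<Sum>k<m. of_real (x k) * u k) ^ 4 \<le> (\<Sum>k<m. cmod (u k)) ^ 4"
      by (intro power_mono) auto
    then show "norm ((form_norm_sq m u x)\<^sup>2) \<le> (\<Sum>k<m. cmod (u k)) ^ 4"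
      by (simp add: form_norm_sq_def flip: power_mult)
  qed
  show "(\<lambda>x. (form_norm_sq m u x)\<^sup>2) \<in> borel_measurable (uniform_cube m)"
    using integral_form_norm_sq(1) by (intro borel_measurable_power) auto
qed

text \<open>The variance of \<open>form_norm_sq m u\<close> is nonnegative, and its mean is
  known.\<close>

lemma second_moment_form_norm_sq_ge:
  "((\<Sum>k<m. (cmod (u k))\<^sup>2) / 3)\<^sup>2 \<le> (\<integral>x. (form_norm_sq m u x)\<^sup>2 \<partial>uniform_cube m)"
proof -
  have "0 \<le> (\<integral>x. (form_norm_sq m u x)\<^sup>2 \<partial>uniform_cube m)
      - (\<integral>x. form_norm_sq m u x \<partial>uniform_cube m)\<^sup>2"
    using uniform_cube.variance_eq[OF integral_form_norm_sq(1) integrable_form_norm_sq_sq, of m u]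
      uniform_cube.variance_positive[of m "form_norm_sq m u"] by simp
  then show ?thesis by (simp add: integral_form_norm_sq(2))
qed

text \<open>The inequality is applied to the squared modulus at level t^2. Its degree 2 produces the
  factor 2 and a square root, which makes the bound linear in \<open>t\<close>.\<close>

lemma carbery_wright_linear_form:
  fixes u :: "nat \<Rightarrow> complex"
  assumes C: "cw_constant C" and "t > 0" and "b > 0" and u: "b\<^sup>2 \<le> (\<Sum>k<m. (cmod (u k))\<^sup>2)"
  shows "measure (uniform_cube m)
      {x \<in> space (uniform_cube m). cmod (\<Sum>k<m. complex_of_real (x k) * u k) \<le> t}
    \<le> 2 * C * sqrt 3 * t / b"
proof -
  define E where "E = (\<integral>x. (form_norm_sq m u x)\<^sup>2 \<partial>uniform_cube m)"
  have "0 < b\<^sup>2" using \<open>b > 0\<close> by simp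
  have "(b\<^sup>2 / 3)\<^sup>2 \<le> ((\<Sum>k<m. (cmod (u k))\<^sup>2) / 3)\<^sup>2"
    using u by (intro power_mono) auto
  also have "\<dots> \<le> E" unfolding E_def by (rule second_moment_form_norm_sq_ge)
  finally have E: "(b\<^sup>2 / 3)\<^sup>2 \<le> E" .
  then have "E > 0" using \<open>b > 0\<close> by (smt (verit) zero_less_power divide_pos_pos)
  have "b\<^sup>2 / 3 \<le> sqrt E" using E real_le_rsqrt by blast
  \<comment> \<open>For \<open>m = 0\<close> the sum is empty and could not reach b^2 > 0.\<close>
  have "m \<ge> 1" using u \<open>0 < b\<^sup>2\<close> by (cases m) auto
  have "C > 0" using C by (simp add: cw_constant_def)
  have eq: "{x \<in> space (uniform_cube m). cmod (\<Sum>k<m. complex_of_real (x k) * u k) \<le> t}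
      = {x \<in> space (uniform_cube m). \<bar>form_norm_sq m u x\<bar> \<le> t\<^sup>2}"
    using \<open>t > 0\<close> by (auto simp: form_norm_sq_def abs_le_square_iff[symmetric])
  have cw: "\<And>m d p \<epsilon>. m \<ge> 1 \<Longrightarrow> d \<ge> 1 \<Longrightarrow> is_poly m d p \<Longrightarrow> \<epsilon> > 0 \<Longrightarrow>
      (\<integral>x. (p x)\<^sup>2 \<partial>uniform_cube m) > 0 \<Longrightarrow>
      measure (uniform_cube m) {x \<in> space (uniform_cube m). \<bar>p x\<bar> \<le> \<epsilon>}
        \<le> C * real d * (\<epsilon> / sqrt (\<integral>x. (p x)\<^sup>2 \<partial>uniform_cube m)) powr (1 / real d)"
    using C unfolding cw_constant_def Let_def by blast
  have "measure (uniform_cube m) {x \<in> space (uniform_cube m). \<bar>form_norm_sq m u x\<bar> \<le> t\<^sup>2}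
      \<le> C * real 2 * (t\<^sup>2 / sqrt E) powr (1 / real 2)"
    using cw[of m 2 "form_norm_sq m u" "t\<^sup>2"] is_poly_form_norm_sq \<open>m \<ge> 1\<close> \<open>t > 0\<close> \<open>E > 0\<close>
    by (simp add: E_def)
  also have "(t\<^sup>2 / sqrt E) powr (1 / real 2) = sqrt (t\<^sup>2 / sqrt E)"
    using \<open>E > 0\<close> by (simp add: powr_half_sqrt)
  also have "sqrt (t\<^sup>2 / sqrt E) \<le> sqrt (t\<^sup>2 / (b\<^sup>2 / 3))"
    using \<open>b\<^sup>2 / 3 \<le> sqrt E\<close> \<open>0 < b\<^sup>2\<close> \<open>E > 0\<close>
    by (intro real_sqrt_le_mono divide_left_mono) (auto intro!: mult_pos_pos)
  also have "sqrt (t\<^sup>2 / (b\<^sup>2 / 3)) = sqrt 3 * t / b"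
    using \<open>t > 0\<close> \<open>b > 0\<close> by (simp add: real_sqrt_divide real_sqrt_mult)
  finally show ?thesis
    using \<open>C > 0\<close> by (simp add: eq mult.assoc mult.left_commute)
qed

section \<open>Grid cells and the passage from the cube to the grid\<close>

lemma grid_props:
  assumes "0 < \<eta>" "1 / \<eta> \<in> \<int>"
  shows "finite (grid \<eta>)" and "grid \<eta> \<noteq> {}" and "real (card (grid \<eta>)) * (\<eta> / 2) = 1"
    and "a \<in> grid \<eta> \<Longrightarrow> -1 \<le> a \<and> a + \<eta> \<le> 1"
    and "a \<in> grid \<eta> \<Longrightarrow> b \<in> grid \<eta> \<Longrightarrow> a < b \<Longrightarrow> a + \<eta> \<le> b"
proof -
  obtain z :: int where z: "1 / \<eta> = of_int z" using assms(2) by (auto elim: Ints_cases)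
  then have "z > 0" using assms(1) by (metis of_int_0_less_iff zero_less_divide_1_iff)
  \<comment> \<open>\<open>N\<close> is the number of grid points, and N\<eta> = 2 is the length of
    [-1,1]; the last point is 1-\<eta>, so its cell still fits.\<close>
  define N where "N = nat (2 * z)"
  have "2 / \<eta> = of_int (2 * z)" using z by (simp add: field_simps)
  then have N: "nat \<lfloor>2 / \<eta>\<rfloor> = N" unfolding N_def by (metis floor_of_int)
  have N\<eta>: "real N * \<eta> = 2" using z assms(1) \<open>z > 0\<close> by (simp add: N_def field_simps)
  have "N > 0" using \<open>z > 0\<close> by (simp add: N_def)
  have g: "grid \<eta> = (\<lambda>k. -1 + real k * \<eta>) ` {0..<N}" by (simp add: grid_def N)
  show "finite (grid \<eta>)" "grid \<eta> \<noteq> {}" using g \<open>N > 0\<close> by auto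
  have "card (grid \<eta>) = N"
    unfolding g using assms(1) by (subst card_image) (auto simp: inj_on_def)
  then show "real (card (grid \<eta>)) * (\<eta> / 2) = 1" using N\<eta> by simp
  show "-1 \<le> a \<and> a + \<eta> \<le> 1" if a: "a \<in> grid \<eta>"
  proof -
    obtain k where k: "k < N" "a = -1 + real k * \<eta>"
      using a unfolding g by auto
    have "real (Suc k) * \<eta> \<le> real N * \<eta>"
      using k assms(1) by (intro mult_right_mono) auto
    moreover have "0 \<le> real k * \<eta>" using assms(1) by simp
    ultimately show ?thesis using k N\<eta> by (simp add: algebra_simps)
  qed
  show "a + \<eta> \<le> b" if ab: "a \<in> grid \<eta>" "b \<in> grid \<eta>" "a < b"
  proof -
    obtain k where k: "a = -1 + real k * \<eta>" using ab(1) unfolding g by auto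
    obtain l where l: "b = -1 + real l * \<eta>" using ab(2) unfolding g by auto
    have "k < l" using k l ab(3) assms(1) by simp
    then have "real (Suc k) * \<eta> \<le> real l * \<eta>"
      using assms(1) by (intro mult_right_mono) auto
    then show ?thesis using k l by (simp add: algebra_simps)
  qed
qed

text \<open>Half-open sides keep neighbouring cells disjoint, and the grid point is the lower corner
  because the grid contains -1 but not 1.\<close>

definition grid_cell :: "nat \<Rightarrow> real \<Rightarrow> (nat \<Rightarrow> real) \<Rightarrow> (nat \<Rightarrow> real) set" where
  "grid_cell m \<eta> a = (\<Pi>\<^sub>E i\<in>{..<m}. {a i..<a i + \<eta>})"

lemma sets_grid_cell: "grid_cell m \<eta> a \<in> sets (uniform_cube m)"
  unfolding grid_cell_def by (rule sets_PiM_I_finite) auto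

lemma measure_grid_cell:
  assumes "0 < \<eta>" "1 / \<eta> \<in> \<int>" and a: "a \<in> {..<m} \<rightarrow>\<^sub>E grid \<eta>"
  shows "measure (uniform_cube m) (grid_cell m \<eta> a) = (\<eta> / 2) ^ m"
proof -
  have "measure uniform_interval {a i..<a i + \<eta>} = \<eta> / 2" if "i < m" for i
  proof -
    have "-1 \<le> a i \<and> a i + \<eta> \<le> 1"
      using a that by (intro grid_props(4)[OF assms(1,2)]) auto
    then have "{-1..1} \<inter> {a i..<a i + \<eta>} = {a i..<a i + \<eta>}" by auto
    then show ?thesis using assms(1) by (subst measure_uniform_measure) auto
  qed
  then show ?thesis
    unfolding grid_cell_def by (subst uniform_cube.prob_times) auto
qed

lemma disjoint_grid_cells:
  assumes "0 < \<eta>" "1 / \<eta> \<in> \<int>" and A: "A \<subseteq> {..<m} \<rightarrow>\<^sub>E grid \<eta>"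
  shows "disjoint_family_on (grid_cell m \<eta>) A"
  unfolding disjoint_family_on_def
proof (intro ballI impI)
  fix a b assume ab: "a \<in> A" "b \<in> A" "a \<noteq> b"
  then obtain i where i: "i < m" "a i \<noteq> b i"
    using A PiE_ext[of a "{..<m}" "\<lambda>_. grid \<eta>" b] by blast
  have g: "a i \<in> grid \<eta>" "b i \<in> grid \<eta>" using A ab i by auto
  have "a i + \<eta> \<le> b i \<or> b i + \<eta> \<le> a i"
    using i(2) grid_props(5)[OF assms(1,2)] g by (meson linorder_neqE_linordered_idom)
  moreover have "x i \<in> {a i..<a i + \<eta>}" "x i \<in> {b i..<b i + \<eta>}"
    if "x \<in> grid_cell m \<eta> a" "x \<in> grid_cell m \<eta> b" for x
    using that i(1) unfolding grid_cell_def by (blast dest: PiE_mem)+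
  ultimately show "grid_cell m \<eta> a \<inter> grid_cell m \<eta> b = {}" by fastforce
qed

text \<open>Each cell has measure (\<eta>/2)^m, the reciprocal of the number of grid points.
  Counting points of \<open>A\<close> therefore measures the disjoint union of their cells.\<close>

lemma grid_fraction_le_measure:
  assumes \<eta>: "0 < \<eta>" "1 / \<eta> \<in> \<int>" and A: "A \<subseteq> {..<m} \<rightarrow>\<^sub>E grid \<eta>"
    and S: "S \<in> sets (uniform_cube m)" and cells: "\<And>a. a \<in> A \<Longrightarrow> grid_cell m \<eta> a \<subseteq> S"
  shows "real (card A) / real (card ({..<m} \<rightarrow>\<^sub>E grid \<eta>)) \<le> measure (uniform_cube m) S"
proof -
  have fin: "finite ({..<m} \<rightarrow>\<^sub>E grid \<eta>)" using grid_props(1)[OF \<eta>] by (intro finite_PiE) auto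
  then have finA: "finite A" using A finite_subset by blast
  have "real (card ({..<m} \<rightarrow>\<^sub>E grid \<eta>)) * (\<eta> / 2) ^ m = 1"
    using grid_props(3)[OF \<eta>] by (simp add: card_PiE flip: power_mult_distrib)
  then have "real (card A) / real (card ({..<m} \<rightarrow>\<^sub>E grid \<eta>)) = real (card A) * (\<eta> / 2) ^ m"
    by (simp only: divide_inverse inverse_unique)
  also have "\<dots> = (\<Sum>a\<in>A. measure (uniform_cube m) (grid_cell m \<eta> a))"
    using measure_grid_cell[OF \<eta>] A by (simp add: subset_iff)
  also have "\<dots> = measure (uniform_cube m) (\<Union>a\<in>A. grid_cell m \<eta> a)"
    using sets_grid_cell disjoint_grid_cells[OF \<eta> A]
    by (intro uniform_cube.finite_measure_finite_Union[symmetric] finA) auto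
  also have "\<dots> \<le> measure (uniform_cube m) S"
    using cells S by (intro uniform_cube.finite_measure_mono) auto
  finally show ?thesis .
qed

text \<open>Cauchy-Schwarz against the all-ones vector. It serves for displacements inside a cell,
  with s = \<eta>, and for grid points themselves, with s = 1.\<close>

lemma linear_form_bounded_coeffs_le:
  fixes u :: "nat \<Rightarrow> complex"
  assumes y: "\<And>k. k < m \<Longrightarrow> \<bar>y k\<bar> \<le> s" and "0 \<le> s" and u: "(\<Sum>k<m. (cmod (u k))\<^sup>2) \<le> B"
  shows "cmod (\<Sum>k<m. complex_of_real (y k) * u k) \<le> s * sqrt (real m * B)"
proof -
  have "cmod (\<Sum>k<m. complex_of_real (y k) * u k) \<le> (\<Sum>k<m. s * cmod (u k))"
    using y by (intro sum_norm_le) (auto simp: norm_mult intro!: mult_right_mono)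
  also have "\<dots> = s * (\<Sum>k<m. 1 * cmod (u k))" by (simp add: sum_distrib_left)
  also have "(\<Sum>k<m. 1 * cmod (u k)) \<le> sqrt (real m * B)"
  proof (rule real_le_rsqrt)
    have "(\<Sum>k<m. 1 * cmod (u k))\<^sup>2 \<le> (\<Sum>k<m. 1\<^sup>2) * (\<Sum>k<m. (cmod (u k))\<^sup>2)"
      by (rule Cauchy_Schwarz_ineq_sum)
    also have "\<dots> \<le> real m * B" using u by (auto intro!: mult_left_mono)
    finally show "(\<Sum>k<m. 1 * cmod (u k))\<^sup>2 \<le> real m * B" .
  qed
  finally show ?thesis using \<open>0 \<le> s\<close> by (simp add: mult_left_mono)
qed

lemma linear_form_cell_le:
  fixes u :: "nat \<Rightarrow> complex"
  assumes x: "x \<in> grid_cell m \<eta> a" and "0 < \<eta>" and u: "(\<Sum>k<m. (cmod (u k))\<^sup>2) \<le> B"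
  shows "cmod (\<Sum>k<m. complex_of_real (x k) * u k)
    \<le> cmod (\<Sum>k<m. complex_of_real (a k) * u k) + \<eta> * sqrt (real m * B)"
proof -
  have "\<bar>x k - a k\<bar> \<le> \<eta>" if "k < m" for k
    using x that by (force simp: grid_cell_def PiE_iff)
  then have "cmod (\<Sum>k<m. complex_of_real (x k - a k) * u k) \<le> \<eta> * sqrt (real m * B)"
    using \<open>0 < \<eta>\<close> u by (intro linear_form_bounded_coeffs_le) auto
  moreover have "(\<Sum>k<m. complex_of_real (x k) * u k)
      = (\<Sum>k<m. complex_of_real (a k) * u k) + (\<Sum>k<m. complex_of_real (x k - a k) * u k)"
    by (simp add: algebra_simps flip: sum.distrib)
  ultimately show ?thesis using norm_triangle_ineq by (smt (verit))
qed

lemma grid_small_linear_form: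
  fixes u :: "nat \<Rightarrow> complex"
  assumes C: "cw_constant C" and \<eta>: "0 < \<eta>" "1 / \<eta> \<in> \<int>"
    and "B > 0" and u: "1 / B \<le> (\<Sum>k<m. (cmod (u k))\<^sup>2)" "(\<Sum>k<m. (cmod (u k))\<^sup>2) \<le> B"
    and "\<delta> > 0"
  shows "real (card {a \<in> {..<m} \<rightarrow>\<^sub>E grid \<eta>. cmod (\<Sum>k<m. complex_of_real (a k) * u k) < \<delta>})
      / real (card ({..<m} \<rightarrow>\<^sub>E grid \<eta>))
    \<le> 2 * C * (sqrt (3 * B) * (\<delta> + \<eta> * sqrt (real m * B)))"
proof -
  define t where "t = \<delta> + \<eta> * sqrt (real m * B)"
  have "0 \<le> \<eta> * sqrt (real m * B)" using \<eta> \<open>B > 0\<close> by simp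
  then have "t > 0" using \<open>\<delta> > 0\<close> by (simp add: t_def)
  let ?S = "{x \<in> space (uniform_cube m). cmod (\<Sum>k<m. complex_of_real (x k) * u k) \<le> t}"
  have "?S \<in> sets (uniform_cube m)" by measurable
  moreover have "grid_cell m \<eta> a \<subseteq> ?S"
    if "a \<in> {a \<in> {..<m} \<rightarrow>\<^sub>E grid \<eta>. cmod (\<Sum>k<m. complex_of_real (a k) * u k) < \<delta>}" for a
    using that linear_form_cell_le[OF _ \<eta>(1) u(2)] sets.sets_into_space[OF sets_grid_cell]
    by (fastforce simp: t_def)
  ultimately have "real (card {a \<in> {..<m} \<rightarrow>\<^sub>E grid \<eta>. cmod (\<Sum>k<m. complex_of_real (a k) * u k) < \<delta>})
      / real (card ({..<m} \<rightarrow>\<^sub>E grid \<eta>)) \<le> measure (uniform_cube m) ?S"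
    by (intro grid_fraction_le_measure[OF \<eta>]) auto
  \<comment> \<open>Here \<open>b = 1 / sqrt B\<close>, from the lower bound on the norm of
    \<open>u\<close>.\<close>
  also have "\<dots> \<le> 2 * C * sqrt 3 * t / (1 / sqrt B)"
    using u(1) \<open>B > 0\<close> \<open>t > 0\<close>
    by (intro carbery_wright_linear_form[OF C]) (auto simp: power_divide)
  also have "2 * C * sqrt 3 * t / (1 / sqrt B) = 2 * C * (sqrt (3 * B) * t)"
    by (simp add: real_sqrt_mult)
  finally show ?thesis by (simp only: t_def)
qed

section \<open>Union bound over the rows\<close>

theorem theorem4p18:
  fixes n r :: nat and T :: "nat \<Rightarrow> nat \<Rightarrow> nat \<Rightarrow> complex"
    and B \<eta> k\<^sub>F C\<^sub>C\<^sub>W :: real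
  assumes "cw_constant C\<^sub>C\<^sub>W"
    and "r_diagonalisable n r T"
    and "kappa_tensor n r T \<le> B"
    and "0 < \<eta>" and "\<eta> < 1" and "1 / \<eta> \<in> \<int>"
    and "k\<^sub>F > real n * B ^ 3"
  shows "real (card {a \<in> {..<n} \<rightarrow>\<^sub>E grid \<eta>.
                vec_space.rank n (slice_comb n T a) = r \<and> kappaF (slice_comb n T a) \<le> k\<^sub>F})
           / real (card ({..<n} \<rightarrow>\<^sub>E grid \<eta>))
         \<ge> 1 - (2 * real r * C\<^sub>C\<^sub>W *
                  (sqrt (3 * B) * (sqrt (real r * B^2 / (k\<^sub>F - real n * B ^ 3)) + \<eta> * sqrt (real n * B)))
                + real r * \<eta> / 2)"
proof -
  \<comment> \<open>The same choice is made inside \<open>kappa_tensor\<close>, so the bound by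
    \<open>B\<close> speaks of this very \<open>U\<close>.\<close>
  define U where "U = (SOME U. diag_decomp n r T U)"
  have decomp: "diag_decomp n r T U"
    using assms(2) unfolding r_diagonalisable_def U_def by (rule someI_ex)
  then have U: "U \<in> carrier_mat r n" "distinct (rows U)"
    "\<not> LinearCombinations.module.lin_dep class_ring (module_vec TYPE(complex) n) (set (rows U))"
    by (auto simp: diag_decomp_def)
  obtain V where V: "V \<in> carrier_mat n r" "U * V = 1\<^sub>m r" "mat_adjoint (V * U) = V * U"
    using lin_indpt_rows_penrose_inverse[OF U] .
  interpret full_row_rank r n U V by unfold_locales (use U V in auto)
  have "fro_sq U + fro_sq V \<le> B"
    using assms(3) pinv_U by (simp add: kappa_tensor_def Let_def U_def)
  then have B: "fro_sq U \<le> B" "fro_sq V \<le> B" "0 \<le> B"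
    using fro_sq_nonneg[of U] fro_sq_nonneg[of V] by auto
  define N where "N = real (card ({..<n} \<rightarrow>\<^sub>E grid \<eta>))"
  define D where "D = k\<^sub>F - real n * B ^ 3"
  \<comment> \<open>This gives B^2/\<delta>^2 = D/r when r > 0, which is at most \<open>D\<close>,
    the part of \<open>k\<^sub>F\<close> left over after n B^3.\<close>
  define \<delta> where "\<delta> = sqrt (real r * B\<^sup>2 / D)"
  define Good where "Good = {a \<in> {..<n} \<rightarrow>\<^sub>E grid \<eta>.
      vec_space.rank n (slice_comb n T a) = r \<and> kappaF (slice_comb n T a) \<le> k\<^sub>F}"
  define Bad where "Bad l = {a \<in> {..<n} \<rightarrow>\<^sub>E grid \<eta>. cmod (row_pairing n U a l) < \<delta>}" for l
  note grid = grid_props[OF assms(4,6)]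
  have "D > 0" using assms(7) by (simp add: D_def)
  \<comment> \<open>A row is needed: \<open>row_norm_sq_ge\<close> then makes
    \<open>fro_sq V\<close> nonzero. For \<open>r = 0\<close> both \<open>U\<close> and
    \<open>V\<close> are empty.\<close>
  have Bpos: "B > 0" if "l < r" for l
    using row_norm_sq_ge[OF that] fro_sq_nonneg[of V] B
    by (cases "fro_sq V = 0") auto
  have \<delta>pos: "\<delta> > 0" if "l < r" for l
    using that Bpos[OF that] \<open>D > 0\<close> by (simp add: \<delta>_def)
  have fin: "finite ({..<n} \<rightarrow>\<^sub>E grid \<eta>)" using grid(1) by (intro finite_PiE) auto
  have "N > 0"
    using fin grid(2) by (simp add: N_def card_gt_0_iff PiE_eq_empty_iff)
  have good: "a \<in> Good" if a: "a \<in> {..<n} \<rightarrow>\<^sub>E grid \<eta>" and nb: "\<And>l. l < r \<Longrightarrow> a \<notin> Bad l" for a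
  proof -
    let ?d = "row_pairing n U a"
    have lower: "\<delta> \<le> cmod (?d l)" if "l < r" for l
      using nb[OF that] a by (auto simp: Bad_def not_less)
    have upper: "cmod (?d l) \<le> sqrt (real n * B)" if l: "l < r" for l
    proof -
      have "\<bar>a k\<bar> \<le> 1" if "k < n" for k
      proof -
        have "a k \<in> grid \<eta>" using a that by auto
        then show ?thesis using grid(4) assms(4) by fastforce
      qed
      then show ?thesis
        unfolding row_pairing_def
        using row_norm_sq_le[OF l] B
          linear_form_bounded_coeffs_le[where s = 1 and y = a and m = n and B = B] by auto
    qed
    have slice: "slice_comb n T a = transpose_mat U * mat_diag r ?d * U"
      by (rule slice_comb_diag_decomp[OF decomp])
    have "vec_space.rank n (slice_comb n T a) = r"
      unfolding slice using lower \<delta>pos by (intro rank_congruence) fastforce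
    moreover have "kappaF (slice_comb n T a) \<le> k\<^sub>F"
    \<comment> \<open>For \<open>r = 0\<close> the value of \<delta> is 0, so the condition bound is
      used with 1 in its place; its conditions on the diagonal are vacuous and both norms
      vanish.\<close>
    proof (cases "r = 0")
      case True
      have "kappaF (slice_comb n T a) \<le> (sqrt (real n * B))\<^sup>2 * (fro_sq U)\<^sup>2 + (fro_sq V)\<^sup>2 / 1\<^sup>2"
        unfolding slice using True by (intro kappaF_congruence_le) auto
      also have "\<dots> = 0" using True carrier_matD[OF V(1)] carrier_matD[OF U(1)]
        by (simp add: fro_sq_def)
      also have "\<dots> \<le> real n * B ^ 3" using B by simp
      finally show ?thesis using assms(7) by simp
    next
      case False
      then have "\<delta> > 0" using \<delta>pos[of 0] by simp
      have "kappaF (slice_comb n T a)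
          \<le> (sqrt (real n * B))\<^sup>2 * (fro_sq U)\<^sup>2 + (fro_sq V)\<^sup>2 / \<delta>\<^sup>2"
        unfolding slice by (intro kappaF_congruence_le \<open>\<delta> > 0\<close> lower upper)
      also have "\<dots> \<le> (sqrt (real n * B))\<^sup>2 * B\<^sup>2 + B\<^sup>2 / \<delta>\<^sup>2"
        using B fro_sq_nonneg
        by (intro add_mono mult_left_mono divide_right_mono power_mono) auto
      also have "(sqrt (real n * B))\<^sup>2 * B\<^sup>2 = real n * B ^ 3"
        using B by (simp add: power2_eq_square power3_eq_cube)
      also have "B\<^sup>2 / \<delta>\<^sup>2 = D / real r"
        using False Bpos[of 0] \<open>D > 0\<close> by (simp add: \<delta>_def)
      also have "D / real r \<le> D"
        using False \<open>D > 0\<close> by (simp add: divide_le_eq)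
      finally show ?thesis by (simp add: D_def)
    qed
    ultimately show ?thesis using a by (simp add: Good_def)
  qed
  have bad: "real (card (Bad l)) / N
      \<le> 2 * C\<^sub>C\<^sub>W * (sqrt (3 * B) * (\<delta> + \<eta> * sqrt (real n * B)))" if l: "l < r" for l
  proof -
    let ?u = "\<Sum>k<n. (cmod (U $$ (l,k)))\<^sup>2"
    have "1 \<le> ?u * fro_sq V" by (rule row_norm_sq_ge[OF l])
    also have "\<dots> \<le> ?u * B" using B by (intro mult_left_mono sum_nonneg) auto
    finally have "1 / B \<le> ?u" using Bpos[OF l] by (simp add: divide_le_eq)
    moreover have "?u \<le> B" using row_norm_sq_le[OF l] B by simp
    ultimately show ?thesis
      unfolding Bad_def N_def row_pairing_def
      using \<delta>pos[OF l] Bpos[OF l]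
      by (intro grid_small_linear_form[OF assms(1,4,6)]) auto
  qed
  \<comment> \<open>A grid point that is bad for no row is good, so the complement of
    \<open>Good\<close> is covered by r sets of small proportion.\<close>
  have "({..<n} \<rightarrow>\<^sub>E grid \<eta>) \<subseteq> Good \<union> (\<Union>l<r. Bad l)"
    using good by blast
  then have "card ({..<n} \<rightarrow>\<^sub>E grid \<eta>) \<le> card (Good \<union> (\<Union>l<r. Bad l))"
    using fin by (intro card_mono) (auto simp: Good_def Bad_def)
  also have "\<dots> \<le> card Good + (\<Sum>l<r. card (Bad l))"
    by (rule order_trans[OF card_Un_le]) (simp add: card_UN_le)
  finally have "N \<le> real (card Good) + (\<Sum>l<r. real (card (Bad l)))"
    unfolding N_def by (simp flip: of_nat_sum of_nat_add)
  then have "1 \<le> (real (card Good) + (\<Sum>l<r. real (card (Bad l)))) / N"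
    using \<open>N > 0\<close> by simp
  also have "\<dots> = real (card Good) / N + (\<Sum>l<r. real (card (Bad l)) / N)"
    by (simp add: add_divide_distrib sum_divide_distrib)
  also have "(\<Sum>l<r. real (card (Bad l)) / N)
      \<le> (\<Sum>l<r. 2 * C\<^sub>C\<^sub>W * (sqrt (3 * B) * (\<delta> + \<eta> * sqrt (real n * B))))"
    using bad by (intro sum_mono) auto
  also have "\<dots> = 2 * real r * C\<^sub>C\<^sub>W * (sqrt (3 * B) * (\<delta> + \<eta> * sqrt (real n * B)))"
    by simp
  finally have "1 - 2 * real r * C\<^sub>C\<^sub>W * (sqrt (3 * B) * (\<delta> + \<eta> * sqrt (real n * B)))
      \<le> real (card Good) / N" by simp
  \<comment> \<open>Subtracting this nonnegative term turns the bound just obtained into the stated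
    one.\<close>
  moreover have "0 \<le> real r * \<eta> / 2" using assms(4) by simp
  ultimately show ?thesis
    unfolding Good_def N_def \<delta>_def D_def by linarith
qed

end
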